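(* Let $(X,\triangleright)$ be a quasi rack such that $$L^0_a(a)=a\qquad\text{and}\qquad L^0_{L_a(b)}=L^0_aL^0_b$$ for all $a,b\in X$. Then $(X,\triangleright)$ is a Płonka sum of racks.
   Context: Juxtaposition of maps denotes composition, $(fg)(x)=f(g(x))$. For a map $f:X\to X$, a relative inverse of $f$ is a map $f^-:X\to X$ with $ff^-f=f$, $f^-ff^-=f^-$, $ff^-=f^-f$; it is unique if it exists, and $f^0:=ff^-=f^-f$. A (left) shelf $(X,\triangleright)$ is a set with a binary operation such that $x\triangleright(y\triangleright z)=(x\triangleright y)\triangleright(x\triangleright z)$ for all $x,y,z$; write $L_x(y)=x\triangleright y$. A rack is a shelf with all $L_x$ bijective. A quasi rack is a shelf such that every $L_x$ has a relative inverse $L_x^-$ and $L_x^0L_y=L_yL_x^0$ for all $x,y\in X$, where $L_x^0=L_xL_x^-=L_x^-L_x$. Płonka sum of racks: let $Y$ be a (lower) semilattice (meet written as product $\alpha\beta$, with $\alpha\ge\beta$ iff $\alpha\beta=\beta$) and $\{(X_\alpha,\triangleright_\alpha)\mid\alpha\in Y\}$ a family of disjoint racks. For all $\alpha\ge\beta$ in $Y$ let $\phi_{\alpha,\beta}:X_\alpha\to X_\beta$ be a rack homomorphism such that $\phi_{\alpha,\alpha}=\mathrm{id}_{X_\alpha}$ for all $\alpha$ and $\phi_{\beta,\gamma}\phi_{\alpha,\beta}=\phi_{\alpha,\gamma}$ whenever $\alpha\ge\beta\ge\gamma$. On $X=\bigcup_{\alpha\in Y}X_\alpha$ set $a\triangleright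 b:=\phi_{\alpha,\alpha\beta}(a)\triangleright_{\alpha\beta}\phi_{\beta,\alpha\beta}(b)$ for $a\in X_\alpha$, $b\in X_\beta$. The resulting shelf $(X,\triangleright)$ is the Płonka sum of the racks $(X_\alpha,\triangleright_\alpha)$ indexed by $Y$; a shelf is a Płonka sum of racks if it arises this way for some such data. *)

theory Defs
  imports "HOL-Algebra.Lattice" "HOL-Library.FuncSet" "HOL-Library.Disjoint_Sets"
begin

text \<open>
  A map \<open>f : X \<rightarrow> X\<close> is represented by a HOL function, of which only the values on \<open>X\<close> matter.
  The relative inverse is normalised to be \<open>undefined\<close> outside \<open>X\<close>, so that uniqueness of the map
  on \<open>X\<close> becomes uniqueness of the HOL function.
\<close>

definition is_rel_inverse :: "'a set \<Rightarrow> ('a \<Rightarrow> 'a) \<Rightarrow> ('a \<Rightarrow> 'a) \<Rightarrow> bool" where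
  "is_rel_inverse X f g \<longleftrightarrow>
     g \<in> X \<rightarrow>\<^sub>E X \<and>
     (\<forall>x\<in>X. f (g (f x)) = f x \<and> g (f (g x)) = g x \<and> f (g x) = g (f x))"

lemma is_rel_inverse_unique:
  assumes f: "f \<in> X \<rightarrow> X" and g: "is_rel_inverse X f g" and h: "is_rel_inverse X f h"
  shows "g = h"
proof (rule extensionalityI)
  show "g \<in> extensional X" "h \<in> extensional X"
    using g h by (auto simp: is_rel_inverse_def PiE_def)
  fix x assume x: "x \<in> X"
  have cl: "f y \<in> X" "g y \<in> X" "h y \<in> X" if "y \<in> X" for y
    using that f g h by (auto simp: is_rel_inverse_def)
  have G: "f (g (f y)) = f y" "g (f (g y)) = g y" "f (g y) = g (f y)" if "y \<in> X" for y
    using that g by (auto simp: is_rel_inverse_def)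
  have H: "f (h (f y)) = f y" "h (f (h y)) = h y" "f (h y) = h (f y)" if "y \<in> X" for y
    using that h by (auto simp: is_rel_inverse_def)
  have eq: "f (g y) = f (h y)" if y: "y \<in> X" for y
  proof -
    have "f (g y) = g (f (h (f y)))" using y G(3) H(1) by simp
    also have "\<dots> = f (g (f (h y)))" using y G(3)[OF cl(1)[OF cl(3)[OF y]]] H(3) by simp
    also have "\<dots> = f (h y)" using G(1)[OF cl(3)[OF y]] .
    finally show ?thesis .
  qed
  have "g x = g (f (g x))" using G(2)[OF x] by (rule sym)
  also have "\<dots> = g (f (h x))" by (simp only: eq[OF x])
  also have "\<dots> = f (g (h x))" using G(3)[OF cl(3)[OF x]] by (rule sym)
  also have "\<dots> = f (h (h x))" by (rule eq[OF cl(3)[OF x]])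
  also have "\<dots> = h (f (h x))" by (rule H(3)[OF cl(3)[OF x]])
  also have "\<dots> = h x" by (rule H(2)[OF x])
  finally show "g x = h x" .
qed

definition rel_inverse :: "'a set \<Rightarrow> ('a \<Rightarrow> 'a) \<Rightarrow> 'a \<Rightarrow> 'a" where
  "rel_inverse X f = (THE g. is_rel_inverse X f g)"

text \<open>The idempotent \<open>f\<^sup>0 = f f\<^sup>-\<close>.\<close>

definition rel_idem :: "'a set \<Rightarrow> ('a \<Rightarrow> 'a) \<Rightarrow> 'a \<Rightarrow> 'a" where
  "rel_idem X f x = f (rel_inverse X f x)"

text \<open>The left multiplication \<open>L\<^sub>x\<close> of an operation \<open>tr\<close> is the partial application \<open>tr x\<close>.\<close>

locale shelf =
  fixes X :: "'a set" and tr :: "'a \<Rightarrow> 'a \<Rightarrow> 'a" (infixr \<open>\<triangleright>\<close> 70)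
  assumes closed: "x \<in> X \<Longrightarrow> y \<in> X \<Longrightarrow> x \<triangleright> y \<in> X"
    and self_distrib:
      "x \<in> X \<Longrightarrow> y \<in> X \<Longrightarrow> z \<in> X \<Longrightarrow> x \<triangleright> (y \<triangleright> z) = (x \<triangleright> y) \<triangleright> (x \<triangleright> z)"

locale rack = shelf +
  assumes bij: "x \<in> X \<Longrightarrow> bij_betw (tr x) X X"

locale quasi_rack = shelf +
  assumes has_rel_inverse: "x \<in> X \<Longrightarrow> \<exists>g. is_rel_inverse X (tr x) g"
    and L0_commute: "x \<in> X \<Longrightarrow> y \<in> X \<Longrightarrow> z \<in> X \<Longrightarrow>
                rel_idem X (tr x) (y \<triangleright> z) = y \<triangleright> rel_idem X (tr x) z"

definition rack_hom ::
  "'a set \<Rightarrow> ('a \<Rightarrow> 'a \<Rightarrow> 'a) \<Rightarrow> 'b set \<Rightarrow> ('b \<Rightarrow> 'b \<Rightarrow> 'b) \<Rightarrow> ('a \<Rightarrow> 'b) set" where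
  "rack_hom X tr X' tr' =
     {h \<in> X \<rightarrow> X'. \<forall>x\<in>X. \<forall>y\<in>X. h (tr x y) = tr' (h x) (h y)}"

locale plonka_system = lower_semilattice Y
  for Y :: "('i, 'm) gorder_scheme" (structure) +
  fixes C :: "'i \<Rightarrow> 'a set"
    and op :: "'i \<Rightarrow> 'a \<Rightarrow> 'a \<Rightarrow> 'a"
    and \<phi> :: "'i \<Rightarrow> 'i \<Rightarrow> 'a \<Rightarrow> 'a"
  assumes disjoint: "disjoint_family_on C (carrier Y)"
    and racks: "\<alpha> \<in> carrier Y \<Longrightarrow> rack (C \<alpha>) (op \<alpha>)"
    and hom: "\<alpha> \<in> carrier Y \<Longrightarrow> \<beta> \<in> carrier Y \<Longrightarrow> \<beta> \<sqsubseteq> \<alpha> \<Longrightarrow>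
                \<phi> \<alpha> \<beta> \<in> rack_hom (C \<alpha>) (op \<alpha>) (C \<beta>) (op \<beta>)"
    and hom_id: "\<alpha> \<in> carrier Y \<Longrightarrow> x \<in> C \<alpha> \<Longrightarrow> \<phi> \<alpha> \<alpha> x = x"
    and hom_comp: "\<alpha> \<in> carrier Y \<Longrightarrow> \<beta> \<in> carrier Y \<Longrightarrow> \<gamma> \<in> carrier Y \<Longrightarrow>
                     \<beta> \<sqsubseteq> \<alpha> \<Longrightarrow> \<gamma> \<sqsubseteq> \<beta> \<Longrightarrow> x \<in> C \<alpha> \<Longrightarrow>
                     \<phi> \<beta> \<gamma> (\<phi> \<alpha> \<beta> x) = \<phi> \<alpha> \<gamma> x"

definition plonka_sum_of ::
  "'a set \<Rightarrow> ('a \<Rightarrow> 'a \<Rightarrow> 'a) \<Rightarrow> ('i, 'm) gorder_scheme \<Rightarrow> ('i \<Rightarrow> 'a set) \<Rightarrow>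
   ('i \<Rightarrow> 'a \<Rightarrow> 'a \<Rightarrow> 'a) \<Rightarrow> ('i \<Rightarrow> 'i \<Rightarrow> 'a \<Rightarrow> 'a) \<Rightarrow> bool" where
  "plonka_sum_of X tr Y C op \<phi> \<longleftrightarrow>
     plonka_system Y C op \<phi> \<and>
     X = (\<Union>\<alpha>\<in>carrier Y. C \<alpha>) \<and>
     (\<forall>\<alpha>\<in>carrier Y. \<forall>\<beta>\<in>carrier Y. \<forall>a\<in>C \<alpha>. \<forall>b\<in>C \<beta>.
        tr a b = op (\<alpha> \<sqinter>\<^bsub>Y\<^esub> \<beta>) (\<phi> \<alpha> (\<alpha> \<sqinter>\<^bsub>Y\<^esub> \<beta>) a) (\<phi> \<beta> (\<alpha> \<sqinter>\<^bsub>Y\<^esub> \<beta>) b))"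

text \<open>
  HOL cannot quantify existentially over the type of indices; indices of type \<open>'a set\<close> lose no
  generality. The indices with nonempty component are closed under meets (if \<open>a \<in> C \<alpha>\<close> and
  \<open>\<beta> \<sqsubseteq> \<alpha>\<close>, then \<open>\<phi> \<alpha> \<beta> a \<in> C \<beta>\<close>), so empty components may be dropped; by disjointness each
  remaining index can then be replaced by its component \<open>C \<alpha>\<close>.
\<close>

definition is_plonka_sum_of_racks :: "'a set \<Rightarrow> ('a \<Rightarrow> 'a \<Rightarrow> 'a) \<Rightarrow> bool" where
  "is_plonka_sum_of_racks X tr \<longleftrightarrow>
     (\<exists>(Y :: 'a set gorder) C op \<phi>. plonka_sum_of X tr Y C op \<phi>)"

end

theory Submission
  imports Defs
begin

text \<open>
  Write \<open>e\<^sub>a = L\<^sub>a\<^sup>0\<close>. In a quasi rack these maps are commuting idempotents, and every \<open>e\<^sub>a\<close> is an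
  endomorphism with \<open>e\<^sub>a (x \<triangleright> y) = e\<^sub>a x \<triangleright> e\<^sub>a y\<close> (\<open>proj_distrib\<close>): since \<open>L\<^sub>a\<close> is an endomorphism that
  does not distinguish \<open>x\<close> from \<open>e\<^sub>a x\<close>, the elements \<open>x \<triangleright> y\<close> and \<open>e\<^sub>a x \<triangleright> y\<close> have the same image
  under \<open>L\<^sub>a\<close>, hence under \<open>e\<^sub>a\<close>.

  The hypothesis \<open>e\<^bsub>a \<triangleright> b\<^esub> = e\<^sub>a e\<^sub>b\<close> says that \<open>a \<mapsto> e\<^sub>a\<close> is a homomorphism onto a semilattice of
  maps, and that semilattice is the index semilattice of the decomposition; the components are
  the fibres of \<open>a \<mapsto> e\<^sub>a\<close>. The other hypothesis \<open>e\<^sub>a a = a\<close> makes \<open>e\<^sub>a\<close> the identity on the fibre of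
  \<open>a\<close>, so \<open>L\<^sub>a\<close> and \<open>L\<^sub>a\<^sup>-\<close> are mutually inverse there and the fibre is a rack. The map from a fibre to a lower one,
  the fibre of \<open>b\<close> say, is \<open>e\<^sub>b\<close>; it lands there because \<open>e\<^bsub>e\<^sub>b x\<^esub> = e\<^sub>b e\<^sub>x\<close> (\<open>proj_proj\<close>).
  Finally \<open>a \<triangleright> b\<close> is fixed by its own idempotent \<open>e = e\<^bsub>a \<triangleright> b\<^esub>\<close>, so
  \<open>a \<triangleright> b = e (a \<triangleright> b) = e a \<triangleright> e b\<close>, which is the defining equation of a Plonka sum.

  All of this is expressed by the preorder \<open>b \<preceq> a \<longleftrightarrow> e\<^sub>a b = b\<close> on \<open>X\<close>, which amounts to
  \<open>e\<^sub>a e\<^sub>b = e\<^sub>b\<close>. The indices are the classes of its equivalence relation, and \<open>a \<triangleright> b\<close> is a greatest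
  lower bound of \<open>a\<close> and \<open>b\<close>.
\<close>

section \<open>Relative inverses\<close>

text \<open>
  With \<open>p = f g = g f\<close>, so that \<open>p f = f = f p\<close>, both \<open>e p\<close> and \<open>p e\<close> equal \<open>p e p\<close>:
  \<open>p e p = p f e g = f e g = e p\<close> and \<open>p e p = g f e p = g e f p = g e f = p e\<close>.
\<close>

lemma is_rel_inverse_idem_commute:
  assumes f: "f \<in> X \<rightarrow> X" and g: "is_rel_inverse X f g" and e: "e \<in> X \<rightarrow> X"
    and comm: "\<And>x. x \<in> X \<Longrightarrow> e (f x) = f (e x)"
    and x: "x \<in> X"
  shows "e (f (g x)) = f (g (e x))"
proof -
  have cl: "f y \<in> X" "g y \<in> X" "e y \<in> X" if "y \<in> X" for y
    using that f g e by (auto simp: is_rel_inverse_def)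
  have G: "f (g (f y)) = f y" "f (g y) = g (f y)" if "y \<in> X" for y
    using that g by (auto simp: is_rel_inverse_def)
  have "e (f (g x)) = f (g (e (f (g x))))"
    using comm G(1) cl x by simp
  also have "\<dots> = g (f (e (f (g x))))"
    using G(2) cl x by simp
  also have "\<dots> = g (e (f (f (g x))))"
    using comm cl x by simp
  also have "f (f (g x)) = f x"
    using G x by simp
  also have "g (e (f x)) = f (g (e x))"
    using comm G(2) cl x by simp
  finally show ?thesis .
qed

section \<open>The idempotents of a quasi rack\<close>

context quasi_rack
begin

abbreviation proj :: "'a \<Rightarrow> 'a \<Rightarrow> 'a" where
  "proj a \<equiv> rel_idem X (tr a)"

lemma is_rel_inverse_rel_inverse:
  assumes a: "a \<in> X"
  shows "is_rel_inverse X (tr a) (rel_inverse X (tr a))"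
proof -
  have "tr a \<in> X \<rightarrow> X"
    using closed a by blast
  then have "\<exists>!g. is_rel_inverse X (tr a) g"
    using has_rel_inverse[OF a] is_rel_inverse_unique by blast
  then show ?thesis
    unfolding rel_inverse_def by (rule theI')
qed

lemma rel_inverse_closed:
  "a \<in> X \<Longrightarrow> x \<in> X \<Longrightarrow> rel_inverse X (tr a) x \<in> X"
  using is_rel_inverse_rel_inverse by (auto simp: is_rel_inverse_def)

lemma proj_closed: "a \<in> X \<Longrightarrow> x \<in> X \<Longrightarrow> proj a x \<in> X"
  unfolding rel_idem_def by (simp add: closed rel_inverse_closed)

lemma proj_alt: "a \<in> X \<Longrightarrow> x \<in> X \<Longrightarrow> proj a x = rel_inverse X (tr a) (a \<triangleright> x)"
  unfolding rel_idem_def using is_rel_inverse_rel_inverse by (simp add: is_rel_inverse_def)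

lemma proj_tr: "a \<in> X \<Longrightarrow> x \<in> X \<Longrightarrow> proj a (a \<triangleright> x) = a \<triangleright> x"
  unfolding rel_idem_def using is_rel_inverse_rel_inverse by (simp add: is_rel_inverse_def)

lemma tr_proj: "a \<in> X \<Longrightarrow> x \<in> X \<Longrightarrow> a \<triangleright> proj a x = a \<triangleright> x"
  using L0_commute proj_tr by simp

lemma proj_rel_inverse:
  assumes "a \<in> X" "x \<in> X"
  shows "proj a (rel_inverse X (tr a) x) = rel_inverse X (tr a) x"
proof -
  have "proj a (rel_inverse X (tr a) x) = rel_inverse X (tr a) (a \<triangleright> rel_inverse X (tr a) x)"
    using assms by (simp only: proj_alt rel_inverse_closed)
  also have "\<dots> = rel_inverse X (tr a) x"
    using is_rel_inverse_rel_inverse[OF assms(1)] assms(2) unfolding is_rel_inverse_def by blast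
  finally show ?thesis .
qed

lemma proj_idem: "a \<in> X \<Longrightarrow> x \<in> X \<Longrightarrow> proj a (proj a x) = proj a x"
  by (simp add: proj_alt proj_rel_inverse closed)

lemma proj_commute:
  assumes "a \<in> X" "b \<in> X" "x \<in> X"
  shows "proj a (proj b x) = proj b (proj a x)"
proof -
  have "proj a (b \<triangleright> rel_inverse X (tr b) x) = b \<triangleright> rel_inverse X (tr b) (proj a x)"
  proof (rule is_rel_inverse_idem_commute[where e = "proj a" and f = "tr b"])
    show "tr b \<in> X \<rightarrow> X" "proj a \<in> X \<rightarrow> X"
      using assms closed proj_closed by auto
    show "is_rel_inverse X (tr b) (rel_inverse X (tr b))"
      using assms(2) by (rule is_rel_inverse_rel_inverse)
    show "proj a (b \<triangleright> y) = b \<triangleright> proj a y" if "y \<in> X" for y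
      using assms that by (simp only: L0_commute)
  qed (rule assms)
  then show ?thesis
    by (simp only: rel_idem_def[of X "tr b"])
qed

text \<open>
  On the right argument this is the axiom \<open>e\<^sub>a L\<^sub>x = L\<^sub>x e\<^sub>a\<close>. The left argument is reached through
  \<open>e\<^sub>a = L\<^sub>a\<^sup>- L\<^sub>a\<close>, because \<open>a \<triangleright> (e\<^sub>a x \<triangleright> y) = (a \<triangleright> x) \<triangleright> (a \<triangleright> y) = a \<triangleright> (x \<triangleright> y)\<close>.
\<close>

lemma proj_distrib:
  assumes a: "a \<in> X" and x: "x \<in> X" and y: "y \<in> X"
  shows "proj a (x \<triangleright> y) = proj a x \<triangleright> proj a y"
proof -
  have "a \<triangleright> (proj a x \<triangleright> y) = a \<triangleright> (x \<triangleright> y)"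
    using assms by (simp add: self_distrib proj_closed tr_proj)
  then have "proj a (x \<triangleright> y) = proj a (proj a x \<triangleright> y)"
    using assms by (simp add: proj_alt[OF a closed] proj_closed)
  also have "\<dots> = proj a x \<triangleright> proj a y"
    using assms by (simp add: L0_commute proj_closed)
  finally show ?thesis .
qed

end

section \<open>The index semilattice\<close>

locale fibred_quasi_rack = quasi_rack +
  assumes proj_self: "a \<in> X \<Longrightarrow> proj a a = a"
    and proj_tr_index: "a \<in> X \<Longrightarrow> b \<in> X \<Longrightarrow> x \<in> X \<Longrightarrow> proj (a \<triangleright> b) x = proj a (proj b x)"
begin

text \<open>
  The element \<open>e\<^sub>a b\<close> has the same idempotent as \<open>a \<triangleright> b\<close>. Indeed \<open>a \<triangleright> e\<^sub>a b = a \<triangleright> b\<close> gives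
  \<open>e\<^sub>a e\<^bsub>e\<^sub>a b\<^esub> = e\<^sub>a e\<^sub>b\<close>, and \<open>e\<^sub>a\<close> is absorbed on the left because \<open>e\<^sub>a b = a \<triangleright> L\<^sub>a\<^sup>- b\<close>.
\<close>

lemma proj_proj:
  assumes a: "a \<in> X" and b: "b \<in> X" and x: "x \<in> X"
  shows "proj (proj a b) x = proj a (proj b x)"
proof -
  let ?c = "rel_inverse X (tr a) b"
  have c: "?c \<in> X"
    using a b by (rule rel_inverse_closed)
  have "proj (proj a b) x = proj (a \<triangleright> ?c) x"
    by (simp only: rel_idem_def[of X "tr a" b])
  also have "\<dots> = proj a (proj (a \<triangleright> ?c) x)"
    using a c x by (simp add: proj_tr_index proj_idem proj_closed)
  also have "\<dots> = proj a (proj (proj a b) x)"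
    by (simp only: rel_idem_def[of X "tr a" b])
  also have "\<dots> = proj (a \<triangleright> proj a b) x"
    using a b x by (simp add: proj_tr_index proj_closed)
  also have "\<dots> = proj a (proj b x)"
    using a b x by (simp add: tr_proj proj_tr_index)
  finally show ?thesis .
qed

definition below :: "'a \<Rightarrow> 'a \<Rightarrow> bool" (infix \<open>\<preceq>\<close> 50) where
  "b \<preceq> a \<longleftrightarrow> proj a b = b"

lemma below_proj_absorb:
  assumes "a \<in> X" "b \<in> X" "b \<preceq> a" "x \<in> X"
  shows "proj a (proj b x) = proj b x" "proj b (proj a x) = proj b x"
proof -
  show "proj a (proj b x) = proj b x"
    using assms proj_proj[of a b x] by (simp add: below_def)
  then show "proj b (proj a x) = proj b x"
    using assms proj_commute by simp
qed

lemma below_refl: "a \<in> X \<Longrightarrow> a \<preceq> a"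
  by (simp add: below_def proj_self)

lemma below_trans:
  assumes "a \<in> X" "b \<in> X" "c \<in> X" "c \<preceq> b" "b \<preceq> a"
  shows "c \<preceq> a"
  using assms below_proj_absorb(1)[of a b c] by (simp add: below_def)

lemma proj_below: "a \<in> X \<Longrightarrow> b \<in> X \<Longrightarrow> proj a b \<preceq> a"
  by (simp add: below_def proj_idem)

lemma tr_below_left: "a \<in> X \<Longrightarrow> b \<in> X \<Longrightarrow> a \<triangleright> b \<preceq> a"
  by (simp add: below_def proj_tr)

lemma tr_below_right: "a \<in> X \<Longrightarrow> b \<in> X \<Longrightarrow> a \<triangleright> b \<preceq> b"
  by (simp add: below_def L0_commute proj_self)

lemma below_tr:
  "a \<in> X \<Longrightarrow> b \<in> X \<Longrightarrow> c \<in> X \<Longrightarrow> c \<preceq> a \<Longrightarrow> c \<preceq> b \<Longrightarrow> c \<preceq> a \<triangleright> b"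
  by (simp add: below_def proj_tr_index)

definition fibre :: "'a \<Rightarrow> 'a set" where
  "fibre a = {b \<in> X. b \<preceq> a \<and> a \<preceq> b}"

lemma fibre_subset: "fibre a \<subseteq> X"
  by (auto simp: fibre_def)

lemma fibre_self: "a \<in> X \<Longrightarrow> a \<in> fibre a"
  by (simp add: fibre_def below_refl)

lemma fibre_eq_iff:
  assumes "a \<in> X" "b \<in> X"
  shows "fibre a = fibre b \<longleftrightarrow> a \<preceq> b \<and> b \<preceq> a"
proof
  assume "fibre a = fibre b"
  then have "a \<in> fibre b"
    using fibre_self[OF \<open>a \<in> X\<close>] by simp
  then show "a \<preceq> b \<and> b \<preceq> a"
    by (simp add: fibre_def)
next
  assume "a \<preceq> b \<and> b \<preceq> a"
  then have "x \<preceq> a \<longleftrightarrow> x \<preceq> b" "a \<preceq> x \<longleftrightarrow> b \<preceq> x" if "x \<in> X" for x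
    using that assms below_trans by blast+
  then show "fibre a = fibre b"
    by (auto simp: fibre_def)
qed

lemma fibre_eqI: "a \<in> X \<Longrightarrow> b \<in> fibre a \<Longrightarrow> fibre b = fibre a"
  by (subst fibre_eq_iff) (auto simp: fibre_def)

lemma fibre_proj_eq:
  assumes "a \<in> X" "b \<in> fibre a" "x \<in> X"
  shows "proj b x = proj a x"
proof -
  have b: "b \<in> X" "b \<preceq> a" "a \<preceq> b"
    using assms by (auto simp: fibre_def)
  have "proj b x = proj a (proj b x)"
    using below_proj_absorb(1)[of a b x] assms b by simp
  also have "\<dots> = proj a x"
    using below_proj_absorb(2)[of b a x] assms b by simp
  finally show ?thesis .
qed

lemma proj_in_fibre:
  assumes "a \<in> X" "b \<in> X" "b \<preceq> a" "x \<in> fibre a"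
  shows "proj b x \<in> fibre b"
proof -
  have x: "x \<in> X" "a \<preceq> x"
    using assms by (auto simp: fibre_def)
  then have "b \<preceq> x"
    using assms below_trans by blast
  then have "b \<preceq> proj b x"
    using assms x by (simp add: below_def proj_proj proj_self)
  then show ?thesis
    using assms x by (simp add: fibre_def proj_below proj_closed)
qed

definition index_semilattice :: "'a set gorder" where
  "index_semilattice =
     \<lparr>carrier = fibre ` X, eq = (=), le = (\<lambda>\<alpha> \<beta>. \<forall>a\<in>\<alpha>. \<forall>b\<in>\<beta>. a \<preceq> b)\<rparr>"

lemma index_carrier: "carrier index_semilattice = fibre ` X"
  by (simp add: index_semilattice_def)

lemma index_le_iff:
  assumes "a \<in> X" "b \<in> X"
  shows "fibre a \<sqsubseteq>\<^bsub>index_semilattice\<^esub> fibre b \<longleftrightarrow> a \<preceq> b"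
proof
  assume "fibre a \<sqsubseteq>\<^bsub>index_semilattice\<^esub> fibre b"
  then show "a \<preceq> b"
    using assms fibre_self by (simp add: index_semilattice_def)
next
  assume ab: "a \<preceq> b"
  have "x \<preceq> y" if "x \<in> fibre a" "y \<in> fibre b" for x y
  proof -
    have xy: "x \<in> X" "y \<in> X" "x \<preceq> a" "b \<preceq> y"
      using that by (auto simp: fibre_def)
    then have "x \<preceq> b"
      using below_trans[of b a x] ab assms by blast
    then show ?thesis
      using below_trans[of y b x] xy assms by blast
  qed
  then show "fibre a \<sqsubseteq>\<^bsub>index_semilattice\<^esub> fibre b"
    by (simp add: index_semilattice_def)
qed

lemma index_partial_order: "partial_order index_semilattice"
proof
  show "(.=\<^bsub>index_semilattice\<^esub>) = (=)"
    by (simp add: index_semilattice_def)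
  then show "x .=\<^bsub>index_semilattice\<^esub> x" if "x \<in> carrier index_semilattice" for x
    by simp
next
  fix \<alpha> \<beta> \<gamma>
  assume "\<alpha> \<in> carrier index_semilattice" "\<beta> \<in> carrier index_semilattice"
    "\<gamma> \<in> carrier index_semilattice"
  then obtain a b c where "a \<in> X" "b \<in> X" "c \<in> X"
    and "\<alpha> = fibre a" "\<beta> = fibre b" "\<gamma> = fibre c"
    by (auto simp: index_carrier)
  moreover assume "\<alpha> \<sqsubseteq>\<^bsub>index_semilattice\<^esub> \<beta>" "\<beta> \<sqsubseteq>\<^bsub>index_semilattice\<^esub> \<gamma>"
  ultimately show "\<alpha> \<sqsubseteq>\<^bsub>index_semilattice\<^esub> \<gamma>"
    using below_trans[of c b a] by (simp add: index_le_iff)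
next
  fix \<alpha> \<beta>
  assume "\<alpha> \<in> carrier index_semilattice" "\<beta> \<in> carrier index_semilattice"
  then obtain a b where "a \<in> X" "b \<in> X" "\<alpha> = fibre a" "\<beta> = fibre b"
    by (auto simp: index_carrier)
  moreover assume "\<alpha> \<sqsubseteq>\<^bsub>index_semilattice\<^esub> \<beta>" "\<beta> \<sqsubseteq>\<^bsub>index_semilattice\<^esub> \<alpha>"
  ultimately have "\<alpha> = \<beta>"
    by (simp add: index_le_iff fibre_eq_iff)
  then show "\<alpha> .=\<^bsub>index_semilattice\<^esub> \<beta>"
    by (simp add: index_semilattice_def)
next
  fix \<alpha>
  assume "\<alpha> \<in> carrier index_semilattice"
  then show "\<alpha> \<sqsubseteq>\<^bsub>index_semilattice\<^esub> \<alpha>"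
    by (auto simp: index_carrier index_le_iff below_refl)
qed (auto simp: index_semilattice_def)

lemma index_glb:
  assumes a: "a \<in> X" and b: "b \<in> X"
  shows "greatest index_semilattice (fibre (a \<triangleright> b))
           (Lower index_semilattice {fibre a, fibre b})"
proof (rule greatest_LowerI)
  show "fibre (a \<triangleright> b) \<sqsubseteq>\<^bsub>index_semilattice\<^esub> \<gamma>" if "\<gamma> \<in> {fibre a, fibre b}" for \<gamma>
    using that a b by (auto simp: index_le_iff closed tr_below_left tr_below_right)
  fix \<gamma>
  assume "\<gamma> \<in> Lower index_semilattice {fibre a, fibre b}"
  then obtain c where "c \<in> X" "\<gamma> = fibre c" "c \<preceq> a" "c \<preceq> b"
    using a b by (auto simp: Lower_def index_carrier index_le_iff)
  then show "\<gamma> \<sqsubseteq>\<^bsub>index_semilattice\<^esub> fibre (a \<triangleright> b)"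
    using a b by (simp add: index_le_iff closed below_tr)
qed (use a b in \<open>auto simp: index_carrier closed\<close>)

lemma index_lower_semilattice: "lower_semilattice index_semilattice"
proof -
  interpret partial_order index_semilattice
    by (rule index_partial_order)
  show ?thesis
    using index_glb by unfold_locales (auto simp: index_carrier)
qed

lemma index_meet:
  assumes "a \<in> X" "b \<in> X"
  shows "fibre a \<sqinter>\<^bsub>index_semilattice\<^esub> fibre b = fibre (a \<triangleright> b)"
  unfolding meet_def inf_def
  by (rule some_equality, rule index_glb[OF assms])
    (rule partial_order.greatest_unique[OF index_partial_order _ index_glb[OF assms]])

section \<open>The fibres as racks\<close>

lemma tr_in_fibre:
  assumes a: "a \<in> X" and b: "b \<in> fibre a" and c: "c \<in> fibre a"
  shows "b \<triangleright> c \<in> fibre a"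
proof -
  have bc: "b \<in> X" "c \<in> X" "a \<preceq> b" "a \<preceq> c" "b \<preceq> a"
    using b c by (auto simp: fibre_def)
  then have "b \<triangleright> c \<preceq> a"
    using a tr_below_left below_trans[of a b "b \<triangleright> c"] closed by blast
  then show ?thesis
    using a bc by (simp add: fibre_def closed below_tr)
qed

lemma rack_fibre:
  assumes a: "a \<in> X"
  shows "rack (fibre a) tr"
proof
  fix x y z
  assume "x \<in> fibre a" "y \<in> fibre a" "z \<in> fibre a"
  then show "x \<triangleright> (y \<triangleright> z) = (x \<triangleright> y) \<triangleright> (x \<triangleright> z)"
    using fibre_subset self_distrib by blast
next
  fix x y
  assume "x \<in> fibre a" "y \<in> fibre a"
  then show "x \<triangleright> y \<in> fibre a"
    using a tr_in_fibre by blast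
next
  fix x
  assume x: "x \<in> fibre a"
  let ?g = "rel_inverse X (tr x)"
  have xX: "x \<in> X"
    using x fibre_subset by blast
  have fix_fibre: "proj x y = y" if "y \<in> fibre a" for y
  proof -
    have "y \<in> fibre x"
      using fibre_eqI[OF a x] that by simp
    then show ?thesis
      by (simp add: fibre_def below_def)
  qed
  have g_fibre: "?g y \<in> fibre a" if y: "y \<in> fibre a" for y
  proof -
    have yX: "y \<in> X"
      using y fibre_subset by blast
    then have gX: "?g y \<in> X"
      using xX rel_inverse_closed by blast
    have g: "?g y \<preceq> x"
      using xX yX by (simp add: below_def proj_rel_inverse)
    \<comment> \<open>\<open>x \<triangleright> ?g y = y\<close>, so \<open>y\<close> lies below \<open>?g y\<close>, and \<open>x\<close> and \<open>y\<close> share a fibre\<close>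
    have "x \<triangleright> ?g y = y"
      using fix_fibre[OF y] by (simp add: rel_idem_def)
    then have "y \<preceq> ?g y"
      using tr_below_right[OF xX gX] by simp
    moreover have "x \<preceq> y"
    proof -
      have "x \<in> fibre y"
        using x fibre_eqI[OF a y] by simp
      then show ?thesis
        by (simp add: fibre_def)
    qed
    ultimately have "x \<preceq> ?g y"
      using below_trans xX yX gX by blast
    then have "?g y \<in> fibre x"
      using g gX by (simp add: fibre_def)
    then show ?thesis
      using fibre_eqI[OF a x] by simp
  qed
  show "bij_betw (tr x) (fibre a) (fibre a)"
  proof (rule bij_betw_byWitness[where f' = ?g])
    show "\<forall>y\<in>fibre a. ?g (x \<triangleright> y) = y"
      using fix_fibre xX fibre_subset by (metis proj_alt subsetD)
    show "\<forall>y\<in>fibre a. x \<triangleright> ?g y = y"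
      using fix_fibre by (simp add: rel_idem_def)
    show "tr x ` fibre a \<subseteq> fibre a"
      using a x tr_in_fibre by blast
    show "?g ` fibre a \<subseteq> fibre a"
      using g_fibre by blast
  qed
qed

section \<open>The decomposition\<close>

text \<open>
  The idempotent is the same for all elements of the target fibre, so any representative serves.
\<close>

definition connecting_map :: "'a set \<Rightarrow> 'a set \<Rightarrow> 'a \<Rightarrow> 'a" where
  "connecting_map \<alpha> \<beta> = proj (SOME b. b \<in> \<beta>)"

lemma connecting_map_fibre:
  assumes "b \<in> X" "x \<in> X"
  shows "connecting_map \<alpha> (fibre b) x = proj b x"
proof -
  have "(SOME c. c \<in> fibre b) \<in> fibre b"
    using fibre_self[OF assms(1)] by (rule someI)
  then show ?thesis
    unfolding connecting_map_def by (rule fibre_proj_eq[OF assms(1) _ assms(2)])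
qed

lemma connecting_map_hom:
  assumes a: "a \<in> X" and b: "b \<in> X" and le: "b \<preceq> a"
  shows "connecting_map (fibre a) (fibre b) \<in> rack_hom (fibre a) tr (fibre b) tr"
proof -
  have "x \<in> X" if "x \<in> fibre a" for x
    using that fibre_subset by blast
  then show ?thesis
    using assms
    by (simp add: rack_hom_def Pi_def connecting_map_fibre proj_in_fibre proj_distrib closed)
qed

lemma plonka_system_fibres:
  "plonka_system index_semilattice (\<lambda>\<alpha>. \<alpha>) (\<lambda>_. tr) connecting_map"
proof (intro plonka_system.intro plonka_system_axioms.intro index_lower_semilattice)
  show "disjoint_family_on (\<lambda>\<alpha>. \<alpha>) (carrier index_semilattice)"
    using fibre_eqI unfolding disjoint_family_on_def index_carrier by blast
next
  fix \<alpha> assume "\<alpha> \<in> carrier index_semilattice"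
  then show "rack \<alpha> tr"
    using rack_fibre by (auto simp: index_carrier)
next
  fix \<alpha> \<beta>
  assume "\<alpha> \<in> carrier index_semilattice" "\<beta> \<in> carrier index_semilattice"
    "\<beta> \<sqsubseteq>\<^bsub>index_semilattice\<^esub> \<alpha>"
  then show "connecting_map \<alpha> \<beta> \<in> rack_hom \<alpha> tr \<beta> tr"
    by (auto simp: index_carrier index_le_iff connecting_map_hom)
next
  fix \<alpha> x
  assume "\<alpha> \<in> carrier index_semilattice" "x \<in> \<alpha>"
  then obtain a where a: "a \<in> X" "\<alpha> = fibre a" and x: "x \<in> X" "x \<preceq> a"
    by (auto simp: index_carrier fibre_def)
  then show "connecting_map \<alpha> \<alpha> x = x"
    by (simp add: connecting_map_fibre below_def)
next
  fix \<alpha> \<beta> \<gamma> x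
  assume "\<alpha> \<in> carrier index_semilattice" "\<beta> \<in> carrier index_semilattice"
    "\<gamma> \<in> carrier index_semilattice" "\<beta> \<sqsubseteq>\<^bsub>index_semilattice\<^esub> \<alpha>"
    "\<gamma> \<sqsubseteq>\<^bsub>index_semilattice\<^esub> \<beta>" "x \<in> \<alpha>"
  moreover from this obtain b c where "b \<in> X" "c \<in> X" "\<beta> = fibre b" "\<gamma> = fibre c"
    by (auto simp: index_carrier)
  moreover have "x \<in> X"
    using calculation fibre_subset by (auto simp: index_carrier)
  ultimately show "connecting_map \<beta> \<gamma> (connecting_map \<alpha> \<beta> x) = connecting_map \<alpha> \<gamma> x"
    by (simp add: index_le_iff connecting_map_fibre proj_closed below_proj_absorb)
qed

lemma plonka_sum_of_fibres:
  "plonka_sum_of X tr index_semilattice (\<lambda>\<alpha>. \<alpha>) (\<lambda>_. tr) connecting_map"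
  unfolding plonka_sum_of_def
proof (intro conjI ballI)
  show "plonka_system index_semilattice (\<lambda>\<alpha>. \<alpha>) (\<lambda>_. tr) connecting_map"
    by (rule plonka_system_fibres)
  show "X = (\<Union>\<alpha>\<in>carrier index_semilattice. \<alpha>)"
    using fibre_self fibre_subset by (auto simp: index_carrier)
next
  fix \<alpha> \<beta> a b
  assume "\<alpha> \<in> carrier index_semilattice" "\<beta> \<in> carrier index_semilattice"
    and ab: "a \<in> \<alpha>" "b \<in> \<beta>"
  then have X: "a \<in> X" "b \<in> X" and "\<alpha> = fibre a" "\<beta> = fibre b"
    using fibre_subset fibre_eqI unfolding index_carrier by blast+
  then have meet: "\<alpha> \<sqinter>\<^bsub>index_semilattice\<^esub> \<beta> = fibre (a \<triangleright> b)"
    by (simp add: index_meet)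
  have "a \<triangleright> b = proj (a \<triangleright> b) (a \<triangleright> b)"
    using X by (simp add: closed proj_self)
  also have "\<dots> = proj (a \<triangleright> b) a \<triangleright> proj (a \<triangleright> b) b"
    using X by (simp add: closed proj_distrib)
  finally show "a \<triangleright> b =
      connecting_map \<alpha> (\<alpha> \<sqinter>\<^bsub>index_semilattice\<^esub> \<beta>) a \<triangleright>
      connecting_map \<beta> (\<alpha> \<sqinter>\<^bsub>index_semilattice\<^esub> \<beta>) b"
    using X by (simp add: meet connecting_map_fibre closed)
qed

end

theorem theorem5p4:
  fixes X :: "'a set" and tr :: "'a \<Rightarrow> 'a \<Rightarrow> 'a"
  assumes "quasi_rack X tr"
    and "\<And>a. a \<in> X \<Longrightarrow> rel_idem X (tr a) a = a"
    and "\<And>a b x. a \<in> X \<Longrightarrow> b \<in> X \<Longrightarrow> x \<in> X \<Longrightarrow>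
           rel_idem X (tr (tr a b)) x = rel_idem X (tr a) (rel_idem X (tr b) x)"
  shows "is_plonka_sum_of_racks X tr"
proof -
  interpret fibred_quasi_rack X tr
    using assms by (intro fibred_quasi_rack.intro fibred_quasi_rack_axioms.intro)
  show ?thesis
    unfolding is_plonka_sum_of_racks_def using plonka_sum_of_fibres by blast
qed

end
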